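(* Let $s\ge 2$, let $\pi$ be a probability vector on $\{1,\dots,s\}$ and let $M$ be a symmetric $s\times s$ matrix with non-negative entries such that $d:=\sum_j M_{ij}\pi_j>0$ does not depend on $i$. Let $T=\frac1d\operatorname{diag}(\pi)M$, with eigenvalues $\lambda_1,\dots,\lambda_s$ ordered so that $1=\lambda_1\ge|\lambda_2|\ge\cdots\ge|\lambda_s|$. Let $\mathbb{P}_n$ be the law of the graph $G$ in the stochastic block model with parameters $(n,M,\pi)$ and let $\mathbb{Q}_n$ be the law of the Erdős–Rényi graph $\mathcal{G}(n,d/n)$. If $d\lambda_2^2>1$, then $\mathbb{P}_n$ and $\mathbb{Q}_n$ are asymptotically orthogonal.
   Context: Stochastic block model $(n,M,\pi)$: each vertex $v\in\{1,\dots,n\}$ receives an independent label $\sigma_v\in\{1,\dots,s\}$ with distribution $\pi$; conditionally on the labels, each edge $\{u,v\}$ is included independently with probability $M_{\sigma_u,\sigma_v}/n$ ($n$ is taken large enough that these are probabilities). $M$ and $\pi$ are fixed as $n\to\infty$. Asymptotically orthogonal: there is a sequence of events $\Omega_n$ (sets of graphs on $\{1,\dots,n\}$) such that $\mathbb{P}_n(\Omega_n)\to1$ and $\mathbb{Q}_n(\Omega_n)\to0$. *)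

theory Defs
  imports "HOL-Probability.Probability" "HOL-Probability.Product_PMF" "Jordan_Normal_Form.Char_Poly"
begin

text \<open>A simple graph on \<open>{1..n}\<close> is given by its set of edges, each edge being a two-element set.\<close>

definition graphs_on :: "nat \<Rightarrow> nat set set set" where
  "graphs_on n = {E. \<forall>e\<in>E. e \<subseteq> {1..n} \<and> card e = 2}"

text \<open>Unordered pairs of vertices are enumerated as pairs \<open>u < v\<close>, so that every edge is decided
  by exactly one coin flip. Since \<^const>\<open>bernoulli_pmf\<close> truncates its parameter to \<open>[0, 1]\<close>, the
  law below is a probability measure for every \<open>p\<close>; the truncation is void when all
  \<open>p u v\<close> lie in \<open>[0, 1]\<close>.\<close>

definition independent_edges_graph :: "nat \<Rightarrow> (nat \<Rightarrow> nat \<Rightarrow> real) \<Rightarrow> nat set set pmf" where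
  "independent_edges_graph n p =
     map_pmf (\<lambda>X. {{u, v} | u v. 1 \<le> u \<and> u < v \<and> v \<le> n \<and> X (u, v)})
       (Pi_pmf {(u, v). 1 \<le> u \<and> u < v \<and> v \<le> n} False (\<lambda>(u, v). bernoulli_pmf (p u v)))"

definition erdos_renyi :: "nat \<Rightarrow> real \<Rightarrow> nat set set pmf" where
  "erdos_renyi n p = independent_edges_graph n (\<lambda>_ _. p)"

text \<open>The \<open>s\<close> labels are \<open>0, \<dots>, s - 1\<close>, matching the row and column indices of \<open>M\<close>; the label
  distribution is a \<open>pmf\<close> supported on them. The second argument of \<^const>\<open>Pi_pmf\<close> is only the
  value of the labelling outside the vertex set. For small \<open>n\<close> the quotient by \<open>n\<close> may exceed 1
  and is then truncated as described above, which happens for at most finitely many \<open>n\<close>.\<close>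

definition stochastic_block_model :: "nat \<Rightarrow> real mat \<Rightarrow> nat pmf \<Rightarrow> nat set set pmf" where
  "stochastic_block_model n M \<pi> =
     bind_pmf (Pi_pmf {1..n} 0 (\<lambda>_. \<pi>))
       (\<lambda>\<sigma>. independent_edges_graph n (\<lambda>u v. M $$ (\<sigma> u, \<sigma> v) / real n))"

definition asymptotically_orthogonal ::
  "(nat \<Rightarrow> nat set set pmf) \<Rightarrow> (nat \<Rightarrow> nat set set pmf) \<Rightarrow> bool" where
  "asymptotically_orthogonal P Q \<longleftrightarrow>
     (\<exists>\<Omega>. (\<forall>n. \<Omega> n \<subseteq> graphs_on n) \<and>
          (\<lambda>n. measure_pmf.prob (P n) (\<Omega> n)) \<longlonglongrightarrow> 1 \<and>
          (\<lambda>n. measure_pmf.prob (Q n) (\<Omega> n)) \<longlonglongrightarrow> 0)"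

definition transition_matrix :: "nat \<Rightarrow> real \<Rightarrow> nat pmf \<Rightarrow> real mat \<Rightarrow> real mat" where
  "transition_matrix s d \<pi> M = (1 / d) \<cdot>\<^sub>m (mat_diag s (pmf \<pi>) * M)"

text \<open>\<open>lam 1, \<dots>, lam s\<close> list the eigenvalues of \<open>A\<close> with algebraic multiplicity, by non-increasing
  absolute value.\<close>

definition ordered_eigenvalues :: "nat \<Rightarrow> real mat \<Rightarrow> (nat \<Rightarrow> real) \<Rightarrow> bool" where
  "ordered_eigenvalues s A lam \<longleftrightarrow>
     char_poly A = (\<Prod>i\<in>{1..s}. [:- lam i, 1:]) \<and>
     (\<forall>i j. 1 \<le> i \<and> i \<le> j \<and> j \<le> s \<longrightarrow> \<bar>lam j\<bar> \<le> \<bar>lam i\<bar>)"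

end

theory Submission
  imports Defs "Jordan_Normal_Form.Schur_Decomposition" "HOL-Real_Asymp.Real_Asymp"
begin

text \<open>The two models are told apart by the number of closed walks of fixed even length \<open>k\<close> along
  distinct vertices, that is, by \<open>2k\<close> times the number of \<open>k\<close>-cycles. As \<open>n \<rightarrow> \<infinity>\<close>, its mean tends to
  \<open>d\<^sup>k \<Sum>\<^sub>i \<lambda>\<^sub>i\<^sup>k \<ge> d\<^sup>k + (d \<lambda>\<^sub>2)\<^sup>k\<close> in the block model and to \<open>d\<^sup>k\<close> in the Erdos--Renyi graph, because
  a label average along a closed walk is a trace of a matrix power. In the second moment, vertex-disjoint
  cycles are uncorrelated, and two distinct cycles which meet span a graph with more edges than vertices,
  so such pairs contribute \<open>O(1/n)\<close>. What remains are the pairs with the same edges, at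
  most \<open>k\<^sup>2\<close> for each cycle, and both variances are \<open>O(k\<^sup>2 d\<^sup>k)\<close>. By Chebyshev's inequality the test
  fails with probability \<open>O(k\<^sup>2 d\<^sup>k / (d \<lambda>\<^sub>2)\<^sup>2\<^sup>k) = O(k\<^sup>2 / (d \<lambda>\<^sub>2\<^sup>2)\<^sup>k)\<close>, which is arbitrarily small for
  large \<open>k\<close>.\<close>

section \<open>Traces of matrix powers\<close>

lemma upper_triangular_times:
  fixes A B :: "'a :: semiring_0 mat"
  assumes A: "A \<in> carrier_mat n n" and B: "B \<in> carrier_mat n n"
    and uA: "upper_triangular A" and uB: "upper_triangular B"
  shows "upper_triangular (A * B)"
    and "i < n \<Longrightarrow> (A * B) $$ (i, i) = A $$ (i, i) * B $$ (i, i)"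
proof -
  have entry: "(A * B) $$ (i, j) = (\<Sum>l<n. A $$ (i, l) * B $$ (l, j))" if "i < n" "j < n" for i j
    using that A B by (simp add: scalar_prod_def lessThan_atLeast0)
  show "upper_triangular (A * B)"
  proof (rule upper_triangularI)
    fix i j assume ij: "j < i" "i < dim_row (A * B)"
    have "A $$ (i, l) * B $$ (l, j) = 0" if "l < n" for l
    proof (cases "l < i")
      case True
      then show ?thesis using upper_triangularD[OF uA, of l i] ij A by simp
    next
      case False
      then show ?thesis using upper_triangularD[OF uB, of j l] ij B that by simp
    qed
    then show "(A * B) $$ (i, j) = 0" using ij A by (subst entry) auto
  qed
  assume i: "i < n"
  have z: "A $$ (i, l) * B $$ (l, i) = 0" if "l < n" "l \<noteq> i" for l
  proof (cases "l < i")
    case True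
    then show ?thesis using upper_triangularD[OF uA, of l i] i A by simp
  next
    case False
    then show ?thesis using upper_triangularD[OF uB, of i l] B that by simp
  qed
  show "(A * B) $$ (i, i) = A $$ (i, i) * B $$ (i, i)"
    using i z by (subst entry) (simp_all add: sum.remove[of _ i])
qed

lemma upper_triangular_pow_mat:
  fixes A :: "'a :: semiring_1 mat"
  assumes A: "A \<in> carrier_mat n n" and uA: "upper_triangular A"
  shows "upper_triangular (A ^\<^sub>m k) \<and> (\<forall>i<n. (A ^\<^sub>m k) $$ (i, i) = A $$ (i, i) ^ k)"
proof (induction k)
  case 0
  then show ?case using A by simp
next
  case (Suc k)
  then show ?case
    using upper_triangular_times[OF pow_carrier_mat[OF A, of k] A _ uA]
    by (simp add: power_commutes)
qed

lemma trace_mult_commute: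
  fixes A B :: "'a :: comm_semiring_0 mat"
  assumes A: "A \<in> carrier_mat n n" and B: "B \<in> carrier_mat n n"
  shows "(\<Sum>i<n. (A * B) $$ (i, i)) = (\<Sum>i<n. (B * A) $$ (i, i))"
proof -
  have "(\<Sum>i<n. (A * B) $$ (i, i)) = (\<Sum>i<n. \<Sum>l<n. A $$ (i, l) * B $$ (l, i))"
    using A B by (intro sum.cong) (auto simp: scalar_prod_def lessThan_atLeast0)
  also have "\<dots> = (\<Sum>l<n. \<Sum>i<n. B $$ (l, i) * A $$ (i, l))"
    by (subst sum.swap) (simp add: mult.commute)
  also have "\<dots> = (\<Sum>i<n. (B * A) $$ (i, i))"
    using A B by (intro sum.cong) (auto simp: scalar_prod_def lessThan_atLeast0)
  finally show ?thesis .
qed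

text \<open>Since the characteristic polynomial splits, a Schur decomposition
  \<open>A = P * B * Q\<close> puts the \<open>lam i\<close> on the diagonal of a triangular
  \<open>B\<close>. Conjugation preserves the trace, and the diagonal of
  \<open>B ^\<^sub>m k\<close> consists of the powers of that of \<open>B\<close>.\<close>

lemma trace_pow_mat_eq_sum_eigenvalues:
  fixes A :: "'a :: conjugatable_ordered_field mat"
  assumes A: "A \<in> carrier_mat n n" and cp: "char_poly A = (\<Prod>i\<in>{1..n}. [:- lam i, 1:])"
  shows "(\<Sum>i<n. (A ^\<^sub>m k) $$ (i, i)) = (\<Sum>i\<in>{1..n}. lam i ^ k)"
proof -
  define es where "es = map lam [1..<Suc n]"
  have "char_poly A = (\<Prod>e\<leftarrow>es. [:- e, 1:])"
    unfolding cp es_def by (simp add: prod.distinct_set_conv_list[symmetric] o_def atLeastLessThanSuc_atLeastAtMost del: upt_Suc)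
  moreover obtain B P Q where s: "schur_decomposition A es = (B, P, Q)"
    by (cases "schur_decomposition A es") auto
  ultimately have sim: "similar_mat_wit A B P Q" and uB: "upper_triangular B" and diag: "diag_mat B = es"
    using schur_decomposition[OF A] by blast+
  note D = similar_mat_witD2[OF A sim]
  have Bk: "B ^\<^sub>m k \<in> carrier_mat n n" using D by simp
  have "(\<Sum>i<n. (A ^\<^sub>m k) $$ (i, i)) = (\<Sum>i<n. (P * (B ^\<^sub>m k * Q)) $$ (i, i))"
    using similar_mat_wit_pow_id[OF sim, of k] D Bk by (simp add: assoc_mult_mat[of _ n n _ n _ n])
  also have "\<dots> = (\<Sum>i<n. (B ^\<^sub>m k * Q * P) $$ (i, i))"
    using D Bk by (intro trace_mult_commute) auto
  also have "B ^\<^sub>m k * Q * P = B ^\<^sub>m k"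
    using D Bk by (simp add: assoc_mult_mat[of _ n n _ n _ n])
  also have "(\<Sum>i<n. (B ^\<^sub>m k) $$ (i, i)) = (\<Sum>i<n. B $$ (i, i) ^ k)"
    using upper_triangular_pow_mat[OF D(5) uB] by simp
  also have "\<dots> = (\<Sum>i<n. lam (Suc i) ^ k)"
  proof (rule sum.cong)
    fix i assume "i \<in> {..<n}"
    then have "i < n" by simp
    then have "B $$ (i, i) = diag_mat B ! i" using D by (simp add: diag_mat_def)
    also have "\<dots> = lam (Suc i)" using \<open>i < n\<close> unfolding diag es_def by (simp del: upt_Suc)
    finally show "B $$ (i, i) ^ k = lam (Suc i) ^ k" by simp
  qed simp
  also have "\<dots> = (\<Sum>i\<in>{1..n}. lam i ^ k)"
    by (rule sum.reindex_bij_witness[of _ "\<lambda>i. i - 1" Suc]) auto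
  finally show ?thesis .
qed

section \<open>Closed walks as traces\<close>

lemma sum_PiE_dflt_insert:
  assumes "a \<notin> A"
  shows "(\<Sum>t\<in>PiE_dflt (insert a A) dflt B. g t) = (\<Sum>t\<in>PiE_dflt A dflt B. \<Sum>x\<in>B a. g (t(a := x)))"
proof -
  have "(\<Sum>t\<in>PiE_dflt (insert a A) dflt B. g t)
      = (\<Sum>(t, x)\<in>PiE_dflt A dflt B \<times> B a. g (t(a := x)))"
    using assms
    by (intro sum.reindex_bij_witness[of _ "\<lambda>(t, x). t(a := x)" "\<lambda>t. (t(a := dflt), t a)"])
       (auto simp: PiE_dflt_def)
  then show ?thesis by (simp add: sum.cartesian_product)
qed

text \<open>Induction on the length by dropping the last vertex. The endpoint weight
  \<open>f\<close> is arbitrary because this step replaces it by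
  \<open>\<lambda>i j. \<Sum>x<n. f i x * A $$ (j, x)\<close>. Functions with a default value are
  the form in which \<open>Pi_pmf\<close> delivers labellings.\<close>

lemma sum_walks:
  fixes A :: "'a :: comm_semiring_1 mat"
  assumes A: "A \<in> carrier_mat n n"
  shows "(\<Sum>t\<in>PiE_dflt {..k} 0 (\<lambda>_. {..<n}). f (t 0) (t k) * (\<Prod>l<k. A $$ (t l, t (Suc l))))
       = (\<Sum>i<n. \<Sum>j<n. f i j * (A ^\<^sub>m k) $$ (i, j))"
proof (induction k arbitrary: f)
  case 0
  have "PiE_dflt {0::nat} (0::nat) (\<lambda>_. {..<n}) = (\<lambda>i. (\<lambda>_::nat. 0::nat)(0 := i)) ` {..<n}"
    by (auto simp: PiE_dflt_def image_iff fun_eq_iff)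
  moreover have "inj_on (\<lambda>i. (\<lambda>_::nat. 0::nat)(0 := i)) {..<n}"
    by (auto simp: inj_on_def fun_eq_iff split: if_splits)
  ultimately have "(\<Sum>t\<in>PiE_dflt {0} 0 (\<lambda>_. {..<n}). f (t 0) (t (0::nat))) = (\<Sum>i<n. f i i)"
    by (simp add: sum.reindex)
  moreover have "(\<Sum>j<n. f i j * (1\<^sub>m n) $$ (i, j)) = f i i" if "i < n" for i
    using that by (simp add: if_distrib[of "\<lambda>x. f i _ * x"] cong: if_cong)
  ultimately show ?case using A by simp
next
  case (Suc k)
  let ?S = "PiE_dflt {..k} 0 (\<lambda>_. {..<n})"
  have "(\<Sum>t\<in>PiE_dflt {..Suc k} 0 (\<lambda>_. {..<n}). f (t 0) (t (Suc k)) * (\<Prod>l<Suc k. A $$ (t l, t (Suc l))))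
      = (\<Sum>t\<in>?S. \<Sum>x<n. f (t 0) x * ((\<Prod>l<k. A $$ (t l, t (Suc l))) * A $$ (t k, x)))"
    unfolding atMost_Suc by (subst sum_PiE_dflt_insert) (auto intro!: sum.cong prod.cong)
  also have "\<dots> = (\<Sum>t\<in>?S. (\<Sum>x<n. f (t 0) x * A $$ (t k, x)) * (\<Prod>l<k. A $$ (t l, t (Suc l))))"
    by (simp add: sum_distrib_left sum_distrib_right mult_ac)
  also have "\<dots> = (\<Sum>i<n. \<Sum>j<n. (\<Sum>x<n. f i x * A $$ (j, x)) * (A ^\<^sub>m k) $$ (i, j))"
    by (rule Suc.IH)
  also have "\<dots> = (\<Sum>i<n. \<Sum>x<n. f i x * (\<Sum>j<n. (A ^\<^sub>m k) $$ (i, j) * A $$ (j, x)))"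
  proof (rule sum.cong)
    fix i
    show "(\<Sum>j<n. (\<Sum>x<n. f i x * A $$ (j, x)) * (A ^\<^sub>m k) $$ (i, j))
        = (\<Sum>x<n. f i x * (\<Sum>j<n. (A ^\<^sub>m k) $$ (i, j) * A $$ (j, x)))"
      unfolding sum_distrib_left sum_distrib_right by (subst sum.swap) (simp add: mult_ac)
  qed simp
  also have "\<dots> = (\<Sum>i<n. \<Sum>x<n. f i x * (A ^\<^sub>m Suc k) $$ (i, x))"
    using pow_carrier_mat[OF A, of k] A
    by (intro sum.cong refl) (simp add: scalar_prod_def lessThan_atLeast0)
  finally show ?case .
qed

text \<open>Cut the closing step: an open walk with endpoint weight \<open>A $$ (j, i)\<close>
  remains, and this weight completes the power to a trace.\<close>

lemma sum_closed_walks: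
  fixes A :: "'a :: comm_semiring_1 mat"
  assumes A: "A \<in> carrier_mat n n" and k: "k > 0"
  shows "(\<Sum>t\<in>PiE_dflt {..<k} 0 (\<lambda>_. {..<n}). \<Prod>l<k. A $$ (t l, t (Suc l mod k)))
       = (\<Sum>i<n. (A ^\<^sub>m k) $$ (i, i))"
proof -
  obtain r where r: "k = Suc r" using k by (cases k) auto
  have "(\<Sum>t\<in>PiE_dflt {..<k} 0 (\<lambda>_. {..<n}). \<Prod>l<k. A $$ (t l, t (Suc l mod k)))
      = (\<Sum>t\<in>PiE_dflt {..r} 0 (\<lambda>_. {..<n}). A $$ (t r, t 0) * (\<Prod>l<r. A $$ (t l, t (Suc l))))"
    unfolding r lessThan_Suc_atMost[of r]
    by (intro sum.cong refl) (simp add: lessThan_Suc_atMost[symmetric] mult.commute)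
  also have "\<dots> = (\<Sum>i<n. \<Sum>j<n. A $$ (j, i) * (A ^\<^sub>m r) $$ (i, j))"
    by (rule sum_walks[OF A, of "\<lambda>i j. A $$ (j, i)"])
  also have "\<dots> = (\<Sum>i<n. (A ^\<^sub>m k) $$ (i, i))"
    using pow_carrier_mat[OF A, of r] A
    by (intro sum.cong refl) (simp add: r scalar_prod_def lessThan_atLeast0 mult.commute)
  finally show ?thesis .
qed

section \<open>Random graphs with an edge kernel\<close>

abbreviation vertex_pairs :: "nat \<Rightarrow> nat set set" where
  "vertex_pairs n \<equiv> {e. e \<subseteq> {1..n} \<and> card e = 2}"

lemma measure_bind_pmf_eq:
  "measure_pmf.prob (bind_pmf M N) X = measure_pmf.expectation M (\<lambda>x. measure_pmf.prob (N x) X)"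
  unfolding measure_pmf_bind
  by (rule measure_pmf.measure_bind[where N = "count_space UNIV"]) (auto simp: measurable_measure_pmf measure_pmf_in_subprob_space)

lemma vertex_pairE:
  assumes "e \<in> vertex_pairs n"
  obtains u v where "e = {u, v}" "1 \<le> u" "u < v" "v \<le> n" "Min e = u" "Max e = v"
proof -
  obtain u v where uv: "e = {u, v}" "u < v"
    using assms by (auto simp: card_2_iff) (metis insert_commute linorder_neqE_nat)
  then show thesis using assms by (intro that[of u v]) auto
qed

text \<open>Containing \<open>F\<close> constrains each coin separately, so it is a box event and
  its probability factorises. \<open>Min e\<close> and \<open>Max e\<close> recover the ordered pair
  whose coin decides \<open>e\<close>.\<close>

lemma prob_independent_edges_superset:
  assumes F: "F \<subseteq> vertex_pairs n"
    and p: "\<And>u v. 1 \<le> u \<Longrightarrow> u < v \<Longrightarrow> v \<le> n \<Longrightarrow> 0 \<le> p u v \<and> p u v \<le> 1"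
  shows "measure_pmf.prob (independent_edges_graph n p) {G. F \<subseteq> G} = (\<Prod>e\<in>F. p (Min e) (Max e))"
proof -
  define I where "I = {(u, v). 1 \<le> u \<and> u < v \<and> v \<le> n}"
  have finI: "finite I"
    by (rule finite_subset[of _ "{1..n} \<times> {1..n}"]) (auto simp: I_def)
  define B where "B = (\<lambda>(u, v). if {u, v} \<in> F then {True} else (UNIV :: bool set))"
  have eqv: "F \<subseteq> {{u, v} |u v. 1 \<le> u \<and> u < v \<and> v \<le> n \<and> X (u, v)} \<longleftrightarrow> X \<in> Pi I B" for X
  proof
    assume L: "F \<subseteq> {{u, v} |u v. 1 \<le> u \<and> u < v \<and> v \<le> n \<and> X (u, v)}"
    show "X \<in> Pi I B"
    proof (rule Pi_I)
      fix x assume "x \<in> I"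
      then obtain u v where x: "x = (u, v)" "u < v" by (auto simp: I_def)
      have "X (u, v)" if "{u, v} \<in> F"
      proof -
        have "{u, v} \<in> {{u, v} |u v. 1 \<le> u \<and> u < v \<and> v \<le> n \<and> X (u, v)}" using L that by (rule subsetD)
        then obtain u' v' where "{u, v} = {u', v'}" "u' < v'" "X (u', v')" by (elim CollectE exE conjE)
        then show ?thesis using x by (auto simp: doubleton_eq_iff)
      qed
      then show "X x \<in> B x" by (auto simp: B_def x)
    qed
  next
    assume R: "X \<in> Pi I B"
    show "F \<subseteq> {{u, v} |u v. 1 \<le> u \<and> u < v \<and> v \<le> n \<and> X (u, v)}"
    proof
      fix e assume e: "e \<in> F"
      then have "e \<in> vertex_pairs n" using F by blast
      then obtain u v where uv: "e = {u, v}" "1 \<le> u" "u < v" "v \<le> n"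
        by (rule vertex_pairE)
      then have "X (u, v) \<in> B (u, v)" using R by (auto simp: I_def Pi_def)
      then have "X (u, v)" using e uv by (simp add: B_def)
      then show "e \<in> {{u, v} |u v. 1 \<le> u \<and> u < v \<and> v \<le> n \<and> X (u, v)}" using uv by blast
    qed
  qed
  have "measure_pmf.prob (independent_edges_graph n p) {G. F \<subseteq> G}
      = measure_pmf.prob (Pi_pmf I False (\<lambda>(u, v). bernoulli_pmf (p u v))) (Pi I B)"
    unfolding independent_edges_graph_def I_def[symmetric] measure_map_pmf
    by (simp only: vimage_def mem_Collect_eq eqv Collect_mem_eq)
  also have "\<dots> = (\<Prod>x\<in>I. measure_pmf.prob ((\<lambda>(u, v). bernoulli_pmf (p u v)) x) (B x))"
    by (rule measure_Pi_pmf_Pi[OF finI])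
  also have "\<dots> = (\<Prod>x\<in>I. if {fst x, snd x} \<in> F then p (fst x) (snd x) else 1)"
    using p by (intro prod.cong refl) (auto simp: B_def I_def measure_pmf_single)
  also have "\<dots> = (\<Prod>x\<in>{x \<in> I. {fst x, snd x} \<in> F}. p (fst x) (snd x))"
    using finI by (simp add: prod.inter_filter)
  also have "\<dots> = (\<Prod>e\<in>F. p (Min e) (Max e))"
  proof (rule prod.reindex_bij_witness[of _ "\<lambda>e. (Min e, Max e)" "\<lambda>x. {fst x, snd x}"])
    fix e assume "e \<in> F"
    then have "e \<in> vertex_pairs n" using F by blast
    then obtain u v where "e = {u, v}" "1 \<le> u" "u < v" "v \<le> n" "Min e = u" "Max e = v"
      by (rule vertex_pairE)
    with \<open>e \<in> F\<close> show "{fst (Min e, Max e), snd (Min e, Max e)} = e" "(Min e, Max e) \<in> {x \<in> I. {fst x, snd x} \<in> F}"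
      by (auto simp: I_def)
  qed (auto simp: I_def)
  finally show ?thesis .
qed

text \<open>Both models are instances, the Erdos-Renyi graph with a constant kernel, so the moment
  bounds are proved once for both. A total function replaces the matrix so that bounds can be stated
  for all labels.\<close>

definition kernel_graph :: "nat \<Rightarrow> (nat \<Rightarrow> nat \<Rightarrow> real) \<Rightarrow> nat pmf \<Rightarrow> nat set set pmf" where
  "kernel_graph n m \<pi> =
     bind_pmf (Pi_pmf {1..n} 0 (\<lambda>_. \<pi>)) (\<lambda>\<sigma>. independent_edges_graph n (\<lambda>u v. m (\<sigma> u) (\<sigma> v) / real n))"

lemma prob_kernel_graph_superset:
  assumes F: "F \<subseteq> vertex_pairs n" and m: "\<And>a b. 0 \<le> m a b" "\<And>a b. m a b \<le> real n"
  shows "measure_pmf.prob (kernel_graph n m \<pi>) {G. F \<subseteq> G}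
       = measure_pmf.expectation (Pi_pmf {1..n} 0 (\<lambda>_. \<pi>)) (\<lambda>\<sigma>. \<Prod>e\<in>F. m (\<sigma> (Min e)) (\<sigma> (Max e)) / real n)"
  unfolding kernel_graph_def measure_bind_pmf_eq
  using m by (intro Bochner_Integration.integral_cong refl prob_independent_edges_superset[OF F])
    (auto simp: divide_le_eq_1)

lemma set_independent_edges_graph: "set_pmf (independent_edges_graph n p) \<subseteq> graphs_on n"
  by (auto simp: independent_edges_graph_def graphs_on_def card_2_iff)

lemma set_kernel_graph: "set_pmf (kernel_graph n m \<pi>) \<subseteq> graphs_on n"
  using set_independent_edges_graph by (fastforce simp: kernel_graph_def)

lemma finite_graphs_on: "finite (graphs_on n)"
  by (rule finite_subset[of _ "Pow (Pow {1..n})"]) (auto simp: graphs_on_def)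

lemma erdos_renyi_eq_kernel_graph: "erdos_renyi n (d / real n) = kernel_graph n (\<lambda>_ _. d) \<pi>"
  by (simp add: erdos_renyi_def kernel_graph_def)

text \<open>Labels lie below \<open>s\<close> almost surely, so the values of the kernel elsewhere
  can be chosen freely.\<close>

lemma stochastic_block_model_eq_kernel_graph:
  assumes "set_pmf \<pi> \<subseteq> {..<s}" and "\<And>i j. i < s \<Longrightarrow> j < s \<Longrightarrow> m i j = M $$ (i, j)"
  shows "stochastic_block_model n M \<pi> = kernel_graph n m \<pi>"
  unfolding stochastic_block_model_def kernel_graph_def
proof (rule bind_pmf_cong)
  fix \<sigma> assume "\<sigma> \<in> set_pmf (Pi_pmf {1..n} 0 (\<lambda>_. \<pi>))"
  then have "\<sigma> v < s" if "1 \<le> v" "v \<le> n" for v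
    using assms(1) that by (auto simp: set_Pi_pmf PiE_dflt_def)
  then show "independent_edges_graph n (\<lambda>u v. M $$ (\<sigma> u, \<sigma> v) / real n)
      = independent_edges_graph n (\<lambda>u v. m (\<sigma> u) (\<sigma> v) / real n)"
    unfolding independent_edges_graph_def
    by (intro arg_cong2[of _ _ _ _ map_pmf] Pi_pmf_cong) (auto simp: assms(2))
qed simp

text \<open>Labels read along distinct vertices are again independent with law \<open>\<pi>\<close>;
  hence all cycles of a given length will have the same probability.\<close>

lemma expectation_Pi_pmf_reindex:
  fixes w :: "'a \<Rightarrow> nat"
  assumes A: "finite A" "finite V" and w: "inj_on w A" "w ` A \<subseteq> V"
    and f: "\<And>t t'. (\<And>x. x \<in> A \<Longrightarrow> t x = t' x) \<Longrightarrow> f t = (f t' :: real)"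
  shows "measure_pmf.expectation (Pi_pmf V dflt (\<lambda>_. \<pi>)) (\<lambda>\<sigma>. f (\<lambda>x. \<sigma> (w x)))
       = measure_pmf.expectation (Pi_pmf A dflt (\<lambda>_. \<pi>)) f"
proof -
  have "Pi_pmf A dflt (\<lambda>_. \<pi>) = map_pmf (\<lambda>\<sigma> x. if x \<in> A then \<sigma> (w x) else dflt) (Pi_pmf V dflt (\<lambda>_. \<pi>))"
  proof -
    \<comment> \<open>Outside \<open>A\<close> the index map must avoid the image of
      \<open>w\<close>, so that the default value is read there; \<open>v0\<close> is such an
      index.\<close>
    obtain v0 where v0: "v0 \<notin> V"
      using ex_new_if_finite[OF infinite_UNIV_nat A(2)] by blast
    define h where "h = (\<lambda>x. if x \<in> A then w x else v0)"
    have "bij_betw h A (w ` A)"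
      using w(1) by (auto simp: bij_betw_def inj_on_def h_def)
    then have "Pi_pmf A dflt (\<lambda>_. \<pi>) = map_pmf (\<lambda>g. g \<circ> h) (Pi_pmf (w ` A) dflt (\<lambda>_. \<pi>))"
      using v0 w(2) by (intro Pi_pmf_bij_betw[OF A(1)]) (auto simp: h_def)
    also have "Pi_pmf (w ` A) dflt (\<lambda>_. \<pi>)
        = map_pmf (\<lambda>g y. if y \<in> w ` A then g y else dflt) (Pi_pmf V dflt (\<lambda>_. \<pi>))"
      by (rule Pi_pmf_subset[OF A(2) w(2)])
    finally show ?thesis
      using v0 w(2)
      by (auto simp: pmf.map_comp o_def h_def fun_eq_iff image_subset_iff intro!: map_pmf_cong dest!: subsetD)
  qed
  then have "measure_pmf.expectation (Pi_pmf A dflt (\<lambda>_. \<pi>)) f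
     = measure_pmf.expectation (Pi_pmf V dflt (\<lambda>_. \<pi>)) (\<lambda>\<sigma>. f (\<lambda>x. if x \<in> A then \<sigma> (w x) else dflt))"
    by simp
  also have "(\<lambda>\<sigma>. f (\<lambda>x. if x \<in> A then \<sigma> (w x) else dflt)) = (\<lambda>\<sigma>. f (\<lambda>x. \<sigma> (w x)))"
    by (intro ext f) auto
  finally show ?thesis by simp
qed

section \<open>Product rule for independent labels\<close>

lemma expectation_pair_pmf_mult:
  fixes f :: "'a \<Rightarrow> real" and g :: "'b \<Rightarrow> real"
  assumes "\<And>x. 0 \<le> f x" "\<And>y. 0 \<le> g y"
  shows "measure_pmf.expectation (pair_pmf P Q) (\<lambda>z. f (fst z) * g (snd z))
       = measure_pmf.expectation P f * measure_pmf.expectation Q g"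
  using assms
  by (simp add: integral_eq_nn_integral nn_integral_pair_pmf' ennreal_mult nn_integral_cmult
      nn_integral_multc enn2real_mult)

text \<open>Cut the labelling into its independent restrictions to \<open>A\<close> and
  \<open>V - A\<close>; \<open>f\<close> reads only the first and \<open>g\<close> only the
  second.\<close>

lemma expectation_Pi_pmf_mult_disjoint:
  fixes f g :: "('a \<Rightarrow> 'b) \<Rightarrow> real"
  assumes V: "finite V" and AB: "A \<subseteq> V" "B \<subseteq> V" "A \<inter> B = {}"
    and f: "\<And>t t'. (\<And>x. x \<in> A \<Longrightarrow> t x = t' x) \<Longrightarrow> f t = f t'" "\<And>t. 0 \<le> f t"
    and g: "\<And>t t'. (\<And>x. x \<in> B \<Longrightarrow> t x = t' x) \<Longrightarrow> g t = g t'" "\<And>t. 0 \<le> g t"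
  shows "measure_pmf.expectation (Pi_pmf V dflt p) (\<lambda>\<sigma>. f \<sigma> * g \<sigma>)
       = measure_pmf.expectation (Pi_pmf V dflt p) f * measure_pmf.expectation (Pi_pmf V dflt p) g"
proof -
  let ?P = "Pi_pmf A dflt p" and ?Q = "Pi_pmf (V - A) dflt p"
  have "finite A" using V AB by (blast intro: finite_subset)
  then have "Pi_pmf (A \<union> (V - A)) dflt p = map_pmf (\<lambda>(s, t) x. if x \<in> A then s x else t x) (pair_pmf ?P ?Q)"
    using V by (intro Pi_pmf_union) auto
  moreover have "A \<union> (V - A) = V" using AB by blast
  ultimately have split: "Pi_pmf V dflt p = map_pmf (\<lambda>z x. if x \<in> A then fst z x else snd z x) (pair_pmf ?P ?Q)"
    by (simp add: case_prod_unfold)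
  have fs: "f (\<lambda>x. if x \<in> A then fst z x else snd z x) = f (fst z)" for z
    by (rule f(1)) auto
  have gs: "g (\<lambda>x. if x \<in> A then fst z x else snd z x) = g (snd z)" for z
    using AB by (intro g(1)) auto
  show ?thesis
    unfolding split using f(2) g(2)
    by (simp add: fs gs expectation_pair_pmf_mult)
qed

section \<open>Combinatorics of cycles\<close>

definition cycle_edges :: "nat \<Rightarrow> (nat \<Rightarrow> nat) \<Rightarrow> nat set set" where
  "cycle_edges k w = (\<lambda>i. {w i, w (Suc i mod k)}) ` {..<k}"

text \<open>Rooted, oriented traversals: for \<open>k \<ge> 3\<close> each \<open>k\<close>-cycle
  appears \<open>2 * k\<close> times. Extensionality identifies a map with its list of
  vertices.\<close>

definition cycle_maps :: "nat \<Rightarrow> nat \<Rightarrow> (nat \<Rightarrow> nat) set" where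
  "cycle_maps n k = {w \<in> {..<k} \<rightarrow>\<^sub>E {1..n}. inj_on w {..<k}}"

lemma finite_cycle_maps: "finite (cycle_maps n k)"
  unfolding cycle_maps_def by (rule finite_subset[of _ "{..<k} \<rightarrow>\<^sub>E {1..n}"]) (auto intro: finite_PiE)

lemma finite_cycle_edges: "finite (cycle_edges k w)"
  by (simp add: cycle_edges_def)

text \<open>Equal edges with different starting points would be traversed in opposite directions, so
  \<open>i\<close> and \<open>j\<close> would succeed each other modulo \<open>k\<close>, forcing
  \<open>k\<close> to divide 2.\<close>

lemma inj_on_cycle_edge:
  assumes k: "k \<ge> 3" and w: "inj_on w {..<k}"
  shows "inj_on (\<lambda>i. {w i, w (Suc i mod k)}) {..<k}"
proof (rule inj_onI)
  fix i j assume i: "i \<in> {..<k}" and j: "j \<in> {..<k}" and e: "{w i, w (Suc i mod k)} = {w j, w (Suc j mod k)}"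
  have m: "Suc i mod k \<in> {..<k}" "Suc j mod k \<in> {..<k}" using k by auto
  from e consider "w i = w j" | "w i = w (Suc j mod k)" "w (Suc i mod k) = w j"
    by (auto simp: doubleton_eq_iff)
  then show "i = j"
  proof cases
    case 1
    then show ?thesis using w i j by (auto dest: inj_onD)
  next
    case 2
    then have "i = Suc j mod k" "Suc i mod k = j"
      using inj_onD[OF w _ i m(2)] inj_onD[OF w _ m(1) j] by auto
    then show ?thesis using k i j by (auto simp: mod_Suc split: if_splits)
  qed
qed

lemma card_cycle_edges:
  assumes "k \<ge> 3" "inj_on w {..<k}"
  shows "card (cycle_edges k w) = k"
  using inj_on_cycle_edge[OF assms] by (simp add: cycle_edges_def card_image)

lemma cycle_edge_neq:
  assumes "k \<ge> 3" "inj_on w {..<k}" "i < k"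
  shows "w i \<noteq> w (Suc i mod k)"
proof
  assume "w i = w (Suc i mod k)"
  then have "i = Suc i mod k" using assms by (intro inj_onD[OF assms(2)]) auto
  then show False using assms by (auto simp: mod_Suc split: if_splits)
qed

lemma cycle_edges_subset_vertex_pairs:
  assumes "k \<ge> 3" "w \<in> cycle_maps n k"
  shows "cycle_edges k w \<subseteq> vertex_pairs n"
proof
  fix e assume "e \<in> cycle_edges k w"
  then obtain i where i: "i < k" "e = {w i, w (Suc i mod k)}" by (auto simp: cycle_edges_def)
  have "w i \<in> {1..n}" "w (Suc i mod k) \<in> {1..n}"
    using assms i by (auto simp: cycle_maps_def PiE_def Pi_def)
  then show "e \<in> vertex_pairs n"
    using cycle_edge_neq[of k w i] assms i by (auto simp: cycle_maps_def)
qed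

lemma Union_cycle_edges: "k > 0 \<Longrightarrow> \<Union> (cycle_edges k w) = w ` {..<k}"
  by (auto simp: cycle_edges_def)

text \<open>Otherwise \<open>S\<close> would be closed under the cyclic successor and, going round
  from \<open>i\<close>, would contain every index.\<close>

lemma cyclic_boundary:
  assumes "i < k" "i \<in> S" "j < k" "j \<notin> S"
  obtains l where "l < k" "l \<in> S" "Suc l mod k \<notin> S"
proof (rule ccontr)
  assume "\<not> thesis"
  with that have closed: "Suc l mod k \<in> S" if "l < k" "l \<in> S" for l using that by blast
  have "(i + r) mod k \<in> S" for r
  proof (induction r)
    case 0
    then show ?case using assms by simp
  next
    case (Suc r)
    then show ?case using closed[of "(i + r) mod k"] assms by (simp add: mod_Suc_eq)
  qed
  \<comment> \<open>Adding \<open>k\<close> keeps the subtraction from truncating; modulo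
    \<open>k\<close> the walk ends at \<open>j\<close>.\<close>
  from this[of "j + k - i"] show False using assms by simp
qed

text \<open>Besides its own new indices, the second cycle leaves the vertex set of the first one along an
  edge starting at an old vertex, whence the extra \<open>1\<close>.\<close>

lemma card_Un_cycle_edges:
  assumes k: "k \<ge> 3" and v: "inj_on v {..<k}" and w: "inj_on w {..<k}"
    and meet: "v ` {..<k} \<inter> w ` {..<k} \<noteq> {}" and neq: "cycle_edges k w \<noteq> cycle_edges k v"
  shows "Suc (k + card {i \<in> {..<k}. w i \<notin> v ` {..<k}}) \<le> card (cycle_edges k v \<union> cycle_edges k w)"
proof -
  let ?e = "\<lambda>i. {w i, w (Suc i mod k)}"
  define New where "New = {i \<in> {..<k}. w i \<notin> v ` {..<k}}"
  define NE where "NE = {i \<in> {..<k}. ?e i \<notin> cycle_edges k v}"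
  have fin: "finite NE" "finite New" by (auto simp: NE_def New_def)
  have old: "w i \<in> v ` {..<k} \<and> w (Suc i mod k) \<in> v ` {..<k}" if "?e i \<in> cycle_edges k v" for i
    using that Union_cycle_edges[of k v] k by (metis UnionI insertI1 insert_commute gr0I not_numeral_le_zero)
  have sub: "New \<subseteq> NE" using old by (auto simp: New_def NE_def)
  \<comment> \<open>Every new vertex starts a new edge, so \<open>New\<close> lies in
    \<open>NE\<close>; an index of \<open>NE\<close> outside \<open>New\<close> remains to be
    found.\<close>
  have "Suc (card New) \<le> card NE"
  proof (cases "New = {}")
    case True
    have "NE \<noteq> {}"
    proof
      assume "NE = {}"
      then have "cycle_edges k w \<subseteq> cycle_edges k v" by (auto simp: NE_def cycle_edges_def)
      then have "cycle_edges k w = cycle_edges k v"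
        using card_cycle_edges[OF k v] card_cycle_edges[OF k w] finite_cycle_edges
        by (intro card_subset_eq) auto
      then show False using neq by simp
    qed
    then show ?thesis using True fin by (simp add: Suc_le_eq card_gt_0_iff)
  next
    case False
    then obtain j where j: "j < k" "j \<in> New" by (auto simp: New_def)
    obtain y where y: "y \<in> v ` {..<k}" "y \<in> w ` {..<k}"
      using meet by (meson disjoint_iff)
    from y(2) obtain i where "i < k" "y = w i" by auto
    with y(1) have i: "i < k" "i \<notin> New" by (simp_all add: New_def)
    \<comment> \<open>Somewhere along \<open>w\<close> an old vertex is followed by a new one; the
      edge between them is new although its starting index is not in \<open>New\<close>.\<close>
    obtain l where l: "l < k" "l \<notin> New" "Suc l mod k \<in> New"
      using cyclic_boundary[of i k "- New" j] i j by auto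
    have "Suc l mod k < k" using k by simp
    then have "l \<in> NE" using l old[of l] by (auto simp: NE_def New_def)
    then have "insert l New \<subseteq> NE" using sub by simp
    then have "card (insert l New) \<le> card NE" using fin by (intro card_mono)
    then show ?thesis using l fin by simp
  qed
  moreover have "cycle_edges k w - cycle_edges k v = ?e ` NE" by (auto simp: cycle_edges_def NE_def)
  moreover have "card (?e ` NE) = card NE"
    using inj_on_cycle_edge[OF k w] by (intro card_image) (auto simp: NE_def inj_on_def)
  moreover have "cycle_edges k v \<union> cycle_edges k w = cycle_edges k v \<union> (cycle_edges k w - cycle_edges k v)" by blast
  moreover have "card \<dots> = k + card (cycle_edges k w - cycle_edges k v)"
    using card_cycle_edges[OF k v] finite_cycle_edges by (subst card_Un_disjoint) auto
  ultimately show ?thesis unfolding New_def by simp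
qed

text \<open>The first two vertices fix root and orientation. Afterwards the edge of \<open>v\<close>
  leaving \<open>v (Suc i)\<close> is one of the two edges of \<open>w\<close> at this vertex, and
  it cannot lead back to \<open>v i\<close> because \<open>v\<close> is injective.\<close>

lemma cycle_determined:
  assumes k: "k \<ge> 3" and v: "inj_on v {..<k}" and w: "inj_on w {..<k}"
    and eq: "cycle_edges k v = cycle_edges k w" and 01: "v 0 = w 0" "v 1 = w 1"
  shows "Suc i < k \<Longrightarrow> v i = w i \<and> v (Suc i) = w (Suc i)"
proof (induction i)
  case 0
  then show ?case using 01 by simp
next
  case (Suc i)
  then have IH: "v i = w i" "v (Suc i) = w (Suc i)" by auto
  have "{v (Suc i), v (Suc (Suc i))} \<in> cycle_edges k v"
    unfolding cycle_edges_def using Suc.prems by (intro image_eqI[of _ _ "Suc i"]) auto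
  then have "{v (Suc i), v (Suc (Suc i))} \<in> cycle_edges k w"
    unfolding eq .
  then obtain j where j: "j < k" "{v (Suc i), v (Suc (Suc i))} = {w j, w (Suc j mod k)}"
    by (auto simp: cycle_edges_def)
  then consider "w (Suc i) = w j" "v (Suc (Suc i)) = w (Suc j mod k)"
    | "w (Suc i) = w (Suc j mod k)" "v (Suc (Suc i)) = w j"
    using IH by (auto simp: doubleton_eq_iff)
  then show ?case
  proof cases
    case 1
    then have "j = Suc i" using inj_onD[OF w 1(1)] j Suc.prems by auto
    then show ?thesis using 1 IH Suc.prems by simp
  next
    case 2
    then have "Suc j mod k = Suc i" using inj_onD[OF w 2(1)] j Suc.prems by auto
    then have "j = i" using j by (auto simp: mod_Suc split: if_splits)
    then have "v (Suc (Suc i)) = v i" using 2 IH by simp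
    then have "Suc (Suc i) = i" using inj_onD[OF v] Suc.prems by auto
    then show ?thesis by simp
  qed
qed

text \<open>A traversal of a given cycle is determined by its first two vertices, each among the at
  most \<open>k\<close> vertices of the cycle. This crude count is enough.\<close>

lemma card_same_cycle_edges:
  assumes k: "k \<ge> 3" and v: "v \<in> cycle_maps n k"
  shows "card {w \<in> cycle_maps n k. cycle_edges k w = cycle_edges k v} \<le> k\<^sup>2"
proof -
  let ?S = "{w \<in> cycle_maps n k. cycle_edges k w = cycle_edges k v}"
  let ?V = "v ` {..<k}"
  have "inj_on (\<lambda>w. (w 0, w 1)) ?S"
  proof (rule inj_onI)
    fix x y assume x: "x \<in> ?S" and y: "y \<in> ?S" and "(x 0, x 1) = (y 0, y (1::nat))"
    then have *: "Suc i < k \<Longrightarrow> x i = y i \<and> x (Suc i) = y (Suc i)" for i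
      by (intro cycle_determined[OF k]) (auto simp: cycle_maps_def)
    have "x i = y i" if "i < k" for i
      using *[of i] *[of "i - 1"] that k by (cases "Suc i < k") auto
    then show "x = y" using x y by (intro PiE_ext[of x "{..<k}" "\<lambda>_. {1..n}" y]) (auto simp: cycle_maps_def)
  qed
  moreover have "(\<lambda>w. (w 0, w 1)) ` ?S \<subseteq> ?V \<times> ?V"
  proof (rule image_subsetI)
    fix w assume "w \<in> ?S"
    then have "w ` {..<k} = ?V" using Union_cycle_edges[of k] k by (metis (mono_tags, lifting) gr0I mem_Collect_eq not_numeral_le_zero)
    then show "(w 0, w 1) \<in> ?V \<times> ?V" using k by auto
  qed
  ultimately have "card ?S \<le> card (?V \<times> ?V)" by (intro card_inj_on_le) auto
  also have "\<dots> \<le> k * k"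
    using card_image_le[of "{..<k}" v] by (simp add: card_cartesian_product mult_le_mono)
  finally show ?thesis by (simp add: power2_eq_square)
qed

section \<open>Number of traversals\<close>

lemma card_cycle_maps: "card (cycle_maps n k) = (\<Prod>i<k. n - i)"
  using card_inj_on_subset_funcset[of "{..<k}" "{1..n}" "{..<k}"]
  by (simp add: cycle_maps_def lessThan_atLeast0)

lemma card_cycle_maps_le: "card (cycle_maps n k) \<le> n ^ k"
proof -
  have "(\<Prod>i<k. n - i) \<le> (\<Prod>i<k. n)" by (intro prod_mono) auto
  then show ?thesis by (simp add: card_cycle_maps)
qed

lemma card_cycle_maps_asymp: "(\<lambda>n. real (card (cycle_maps n k)) / real n ^ k) \<longlonglongrightarrow> 1"
proof -
  have "(\<lambda>n. \<Prod>i<k. (real n - real i) / real n) \<longlonglongrightarrow> (\<Prod>i<k. 1)"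
    by (intro tendsto_prod) real_asymp
  moreover have "eventually (\<lambda>n. (\<Prod>i<k. (real n - real i) / real n) = real (card (cycle_maps n k)) / real n ^ k) sequentially"
    using eventually_ge_at_top[of k]
  proof eventually_elim
    case (elim n)
    then show ?case by (simp add: card_cycle_maps prod_dividef of_nat_diff)
  qed
  ultimately show ?thesis by (simp add: tendsto_cong)
qed

text \<open>Without injectivity the sum factorises over the indices. At each index the at most
  \<open>n\<close> vertices outside \<open>V\<close> contribute at most 1 in total, by the weight
  \<open>1 / n\<close>, and those in \<open>V\<close> at most \<open>k\<close>.\<close>

lemma sum_new_vertices_le:
  assumes n: "n > 0" and V: "finite V" "card V \<le> k"
  shows "(\<Sum>w\<in>cycle_maps n k. (1 / real n) ^ card {i \<in> {..<k}. w i \<notin> V}) \<le> real (k + 1) ^ k"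
proof -
  have "(\<Sum>w\<in>cycle_maps n k. (1 / real n) ^ card {i \<in> {..<k}. w i \<notin> V})
      \<le> (\<Sum>w\<in>{..<k} \<rightarrow>\<^sub>E {1..n}. (1 / real n) ^ card {i \<in> {..<k}. w i \<notin> V})"
    by (intro sum_mono2) (auto simp: cycle_maps_def finite_PiE)
  also have "\<dots> = (\<Sum>w\<in>{..<k} \<rightarrow>\<^sub>E {1..n}. \<Prod>i<k. if w i \<notin> V then 1 / real n else 1)"
    by (simp add: prod.If_cases Int_def)
  also have "\<dots> = (\<Prod>i<k. \<Sum>x\<in>{1..n}. if x \<notin> V then 1 / real n else 1)"
    by (subst prod_sum_PiE) auto
  also have "\<dots> \<le> (\<Prod>i<k. real (k + 1))"
  proof (intro prod_mono conjI sum_nonneg)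
    have "(\<Sum>x\<in>{1..n}. if x \<notin> V then 1 / real n else 1)
        \<le> (\<Sum>x\<in>{1..n}. 1 / real n + (if x \<in> V then 1 else 0))"
      using n by (intro sum_mono) auto
    also have "\<dots> = 1 + real (card ({1..n} \<inter> V))"
      using n by (simp add: sum.distrib sum.If_cases)
    also have "\<dots> \<le> real (k + 1)"
      using V card_mono[OF V(1), of "{1..n} \<inter> V"] by simp
    finally show "(\<Sum>x\<in>{1..n}. if x \<notin> V then 1 / real n else 1) \<le> real (k + 1)" .
  qed auto
  finally show ?thesis by simp
qed

section \<open>Moments of the cycle count\<close>

definition cycle_count :: "nat \<Rightarrow> nat \<Rightarrow> nat set set \<Rightarrow> real" where
  "cycle_count n k G = real (card {w \<in> cycle_maps n k. cycle_edges k w \<subseteq> G})"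

lemma cycle_count_eq_sum:
  "cycle_count n k G = (\<Sum>w\<in>cycle_maps n k. indicator {G. cycle_edges k w \<subseteq> G} G)"
proof -
  have "(\<Sum>w\<in>cycle_maps n k. indicator {G. cycle_edges k w \<subseteq> G} G)
      = (\<Sum>w\<in>cycle_maps n k. if cycle_edges k w \<subseteq> G then 1 else (0::real))"
    by (intro sum.cong) auto
  then show ?thesis
    using finite_cycle_maps[of n k] by (simp add: cycle_count_def sum.If_cases Int_def)
qed

lemma cycle_count_bounds: "0 \<le> cycle_count n k G" "cycle_count n k G \<le> real (card (cycle_maps n k))"
  unfolding cycle_count_def using finite_cycle_maps by (auto intro!: card_mono)

lemma integrable_bounded_pmf:
  fixes f :: "'a \<Rightarrow> real"
  assumes "\<And>x. 0 \<le> f x" "\<And>x. f x \<le> K"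
  shows "integrable (measure_pmf p) f"
  using assms by (intro measure_pmf.integrable_const_bound[of _ K]) auto

lemma expectation_cycle_count:
  "measure_pmf.expectation P (cycle_count n k)
     = (\<Sum>w\<in>cycle_maps n k. measure_pmf.prob P {G. cycle_edges k w \<subseteq> G})"
  unfolding cycle_count_eq_sum[abs_def]
  by (subst Bochner_Integration.integral_sum) (auto intro!: integrable_bounded_pmf[of _ 1])

lemma expectation_cycle_count_square:
  "measure_pmf.expectation P (\<lambda>G. (cycle_count n k G)\<^sup>2)
     = (\<Sum>v\<in>cycle_maps n k. \<Sum>w\<in>cycle_maps n k. measure_pmf.prob P {G. cycle_edges k v \<union> cycle_edges k w \<subseteq> G})"
proof -
  have "(cycle_count n k G)\<^sup>2
      = (\<Sum>v\<in>cycle_maps n k. \<Sum>w\<in>cycle_maps n k. indicator {G. cycle_edges k v \<union> cycle_edges k w \<subseteq> G} G)" for G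
    unfolding cycle_count_eq_sum power2_eq_square sum_product
    by (intro sum.cong refl) (auto simp: indicator_def)
  then show ?thesis
    by (simp add: Bochner_Integration.integral_sum integrable_bounded_pmf[of _ 1])
qed

text \<open>The homomorphism density of the \<open>k\<close>-cycle in the kernel \<open>m\<close>.
  For \<open>k \<ge> 3\<close> it is the limit of the mean of \<open>cycle_count\<close>.\<close>

definition cycle_moment :: "(nat \<Rightarrow> nat \<Rightarrow> real) \<Rightarrow> nat pmf \<Rightarrow> nat \<Rightarrow> real" where
  "cycle_moment m \<pi> k =
     measure_pmf.expectation (Pi_pmf {..<k} 0 (\<lambda>_. \<pi>)) (\<lambda>t. \<Prod>i<k. m (t i) (t (Suc i mod k)))"

text \<open>Symmetry makes the value on an edge independent of its orientation. The condition
  \<open>1 \<le> C\<close> lets powers of \<open>C\<close> be bounded by higher ones.\<close>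

locale edge_kernel =
  fixes m :: "nat \<Rightarrow> nat \<Rightarrow> real" and C :: real and \<pi> :: "nat pmf"
  assumes sym: "m a b = m b a" and nonneg: "0 \<le> m a b" and le_C: "m a b \<le> C" and C_ge_1: "1 \<le> C"
begin

lemma cycle_moment_nonneg: "0 \<le> cycle_moment m \<pi> k"
  unfolding cycle_moment_def by (intro Bochner_Integration.integral_nonneg prod_nonneg nonneg)

lemma kernel_Min_Max: "m (\<sigma> (Min {u, v})) (\<sigma> (Max {u, v})) = m (\<sigma> u) (\<sigma> v)" for u v :: nat
  by (cases u v rule: linorder_cases) (auto simp: sym min_def max_def)

lemma prod_cycle_edges:
  assumes "k \<ge> 3" "inj_on w {..<k}"
  shows "(\<Prod>e\<in>cycle_edges k w. m (\<sigma> (Min e)) (\<sigma> (Max e)) / real n)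
       = (\<Prod>i<k. m (\<sigma> (w i)) (\<sigma> (w (Suc i mod k)))) / real n ^ k"
proof -
  have "(\<Prod>e\<in>cycle_edges k w. m (\<sigma> (Min e)) (\<sigma> (Max e)) / real n)
      = (\<Prod>i<k. m (\<sigma> (w i)) (\<sigma> (w (Suc i mod k))) / real n)"
    unfolding cycle_edges_def
    by (subst prod.reindex[OF inj_on_cycle_edge[OF assms]]) (simp only: o_def kernel_Min_Max)
  then show ?thesis by (simp add: prod_dividef)
qed

lemma expectation_prod_cycle_edges:
  assumes k: "k \<ge> 3" and w: "w \<in> cycle_maps n k"
  shows "measure_pmf.expectation (Pi_pmf {1..n} 0 (\<lambda>_. \<pi>))
           (\<lambda>\<sigma>. \<Prod>e\<in>cycle_edges k w. m (\<sigma> (Min e)) (\<sigma> (Max e)) / real n)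
       = cycle_moment m \<pi> k / real n ^ k"
proof -
  have inj: "inj_on w {..<k}" and im: "w ` {..<k} \<subseteq> {1..n}" using w by (auto simp: cycle_maps_def)
  have "measure_pmf.expectation (Pi_pmf {1..n} 0 (\<lambda>_. \<pi>)) (\<lambda>\<sigma>. \<Prod>i<k. m (\<sigma> (w i)) (\<sigma> (w (Suc i mod k))))
      = cycle_moment m \<pi> k"
    unfolding cycle_moment_def
    using k by (intro expectation_Pi_pmf_reindex[OF _ _ inj im]) (auto intro!: prod.cong arg_cong2[of _ _ _ _ m])
  then show ?thesis by (simp add: prod_cycle_edges[OF k inj])
qed

text \<open>From here on all quotients \<open>m a b / n\<close> are probabilities, so no coin
  parameter is truncated.\<close>

context
  fixes n :: nat
  assumes C_le: "C \<le> real n"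
begin

lemma le_n: "m a b \<le> real n"
  using le_C[of a b] C_le by simp

lemma prob_cycle:
  assumes k: "k \<ge> 3" and w: "w \<in> cycle_maps n k"
  shows "measure_pmf.prob (kernel_graph n m \<pi>) {G. cycle_edges k w \<subseteq> G} = cycle_moment m \<pi> k / real n ^ k"
  using expectation_prod_cycle_edges[OF assms]
  by (simp add: prob_kernel_graph_superset[OF cycle_edges_subset_vertex_pairs[OF assms] nonneg le_n])

text \<open>Edges are independent only given the labels. Cycles on disjoint vertex sets share no
  label either, so their probabilities multiply exactly.\<close>

lemma prob_disjoint_cycles:
  assumes k: "k \<ge> 3" and v: "v \<in> cycle_maps n k" and w: "w \<in> cycle_maps n k"
    and disj: "v ` {..<k} \<inter> w ` {..<k} = {}"
  shows "measure_pmf.prob (kernel_graph n m \<pi>) {G. cycle_edges k v \<union> cycle_edges k w \<subseteq> G}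
       = (cycle_moment m \<pi> k / real n ^ k)\<^sup>2"
proof -
  let ?E = "measure_pmf.expectation (Pi_pmf {1..n} 0 (\<lambda>_. \<pi>))"
  let ?f = "\<lambda>F \<sigma>. \<Prod>e\<in>F. m (\<sigma> (Min e)) (\<sigma> (Max e)) / real n"
  have inj: "inj_on v {..<k}" "inj_on w {..<k}" and im: "v ` {..<k} \<subseteq> {1..n}" "w ` {..<k} \<subseteq> {1..n}"
    using v w by (auto simp: cycle_maps_def)
  have "cycle_edges k v \<inter> cycle_edges k w = {}"
  proof (rule equals0I)
    fix e assume "e \<in> cycle_edges k v \<inter> cycle_edges k w"
    then have e: "e \<in> cycle_edges k v" "e \<in> cycle_edges k w" by auto
    have "e \<subseteq> \<Union> (cycle_edges k v)" "e \<subseteq> \<Union> (cycle_edges k w)" using e by (auto simp only: Union_upper)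
    then have "e \<subseteq> v ` {..<k} \<inter> w ` {..<k}" using k by (simp add: Union_cycle_edges)
    moreover have "e \<noteq> {}" using e(1) by (auto simp: cycle_edges_def)
    ultimately show False using disj by simp
  qed
  then have split: "?f (cycle_edges k v \<union> cycle_edges k w) \<sigma> = ?f (cycle_edges k v) \<sigma> * ?f (cycle_edges k w) \<sigma>" for \<sigma>
    by (intro prod.union_disjoint finite_cycle_edges)
  have local: "?f (cycle_edges k x) t = ?f (cycle_edges k x) t'"
    if "inj_on x {..<k}" "\<And>y. y \<in> x ` {..<k} \<Longrightarrow> t y = t' y" for x t t'
    using that k by (simp add: prod_cycle_edges[OF k])
  have "measure_pmf.prob (kernel_graph n m \<pi>) {G. cycle_edges k v \<union> cycle_edges k w \<subseteq> G}
      = ?E (?f (cycle_edges k v \<union> cycle_edges k w))"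
    using cycle_edges_subset_vertex_pairs[OF k v] cycle_edges_subset_vertex_pairs[OF k w]
    by (intro prob_kernel_graph_superset nonneg le_n Un_least)
  also have "\<dots> = ?E (?f (cycle_edges k v)) * ?E (?f (cycle_edges k w))"
    unfolding split
    by (rule expectation_Pi_pmf_mult_disjoint[OF _ im disj])
      (auto intro!: local inj prod_nonneg simp: nonneg)
  also have "\<dots> = (cycle_moment m \<pi> k / real n ^ k)\<^sup>2"
    unfolding expectation_prod_cycle_edges[OF k v] expectation_prod_cycle_edges[OF k w]
    by (simp add: power2_eq_square)
  finally show ?thesis .
qed

lemma prob_superset_le:
  assumes F: "F \<subseteq> vertex_pairs n"
  shows "measure_pmf.prob (kernel_graph n m \<pi>) {G. F \<subseteq> G} \<le> (C / real n) ^ card F"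
proof -
  have b: "(\<Prod>e\<in>F. m (\<sigma> (Min e)) (\<sigma> (Max e)) / real n) \<le> (C / real n) ^ card F" for \<sigma>
  proof -
    have "(\<Prod>e\<in>F. m (\<sigma> (Min e)) (\<sigma> (Max e)) / real n) \<le> (\<Prod>e\<in>F. C / real n)"
      using nonneg le_C by (intro prod_mono) (auto intro!: divide_right_mono)
    then show ?thesis by simp
  qed
  show ?thesis
    unfolding prob_kernel_graph_superset[OF F nonneg le_n]
    by (intro measure_pmf.integral_le_const integrable_bounded_pmf[of _ "(C / real n) ^ card F"] b AE_I2 prod_nonneg)
      (auto simp: nonneg)
qed

lemma expectation_cycle_count_kernel:
  assumes k: "k \<ge> 3"
  shows "measure_pmf.expectation (kernel_graph n m \<pi>) (cycle_count n k)
       = real (card (cycle_maps n k)) / real n ^ k * cycle_moment m \<pi> k"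
  by (simp add: expectation_cycle_count prob_cycle[OF k])

text \<open>With \<open>r\<close> vertices of \<open>w\<close> off the first cycle the union has at
  least \<open>k + r + 1\<close> edges, each costing a factor \<open>C / n\<close>. The power
  \<open>(1 / n) ^ r\<close> is kept apart, to be balanced by the choices of new vertices in
  \<open>sum_new_vertices_le\<close>; \<open>r \<le> k\<close> frees the constant from
  \<open>r\<close>.\<close>

lemma prob_overlapping_cycles_le:
  assumes k: "k \<ge> 3" and v: "v \<in> cycle_maps n k" and w: "w \<in> cycle_maps n k"
    and meet: "v ` {..<k} \<inter> w ` {..<k} \<noteq> {}" and neq: "cycle_edges k w \<noteq> cycle_edges k v"
  shows "measure_pmf.prob (kernel_graph n m \<pi>) {G. cycle_edges k v \<union> cycle_edges k w \<subseteq> G}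
       \<le> C ^ (2 * k + 1) / real n ^ (k + 1) * (1 / real n) ^ card {i \<in> {..<k}. w i \<notin> v ` {..<k}}"
proof -
  let ?F = "cycle_edges k v \<union> cycle_edges k w"
  define r where "r = card {i \<in> {..<k}. w i \<notin> v ` {..<k}}"
  have "r \<le> card {..<k}" unfolding r_def by (intro card_mono) auto
  then have r: "r \<le> k" by simp
  have n: "0 < real n" using C_le C_ge_1 by simp
  have "measure_pmf.prob (kernel_graph n m \<pi>) {G. ?F \<subseteq> G} \<le> (C / real n) ^ card ?F"
    using cycle_edges_subset_vertex_pairs[OF k v] cycle_edges_subset_vertex_pairs[OF k w]
    by (intro prob_superset_le Un_least)
  also have "\<dots> \<le> (C / real n) ^ Suc (k + r)"
    using card_Un_cycle_edges[OF k _ _ meet neq] v w C_ge_1 C_le n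
    by (intro power_decreasing) (auto simp: cycle_maps_def r_def)
  also have "\<dots> = C ^ Suc (k + r) * (1 / real n ^ (k + 1) * (1 / real n) ^ r)"
    using n by (simp add: power_add power_divide)
  also have "\<dots> \<le> C ^ (2 * k + 1) * (1 / real n ^ (k + 1) * (1 / real n) ^ r)"
    using C_ge_1 r by (intro mult_right_mono power_increasing) auto
  finally show ?thesis by (simp add: r_def)
qed

lemma variance_cycle_count_le:
  assumes k: "k \<ge> 3"
  shows "measure_pmf.variance (kernel_graph n m \<pi>) (cycle_count n k)
       \<le> real k ^ 2 * cycle_moment m \<pi> k + C ^ (2 * k + 1) * real (k + 1) ^ k / real n"
proof -
  let ?P = "kernel_graph n m \<pi>" and ?W = "cycle_maps n k"
  let ?p = "\<lambda>v w. measure_pmf.prob ?P {G. cycle_edges k v \<union> cycle_edges k w \<subseteq> G}"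
  let ?q = "cycle_moment m \<pi> k / real n ^ k"
  let ?K = "C ^ (2 * k + 1) / real n ^ (k + 1)"
  let ?new = "\<lambda>v w. card {i \<in> {..<k}. w i \<notin> v ` {..<k}}"
  have n: "0 < real n" using C_le C_ge_1 by simp
  have q: "0 \<le> ?q" using cycle_moment_nonneg[of k] by simp
  \<comment> \<open>The three nonnegative summands cover in turn disjoint pairs, pairs with equal
    edge sets and the remaining ones. Granting all three to every pair lets each be summed
    separately.\<close>
  have bound: "?p v w \<le> ?q\<^sup>2 + (if cycle_edges k w = cycle_edges k v then ?q else 0)
                  + ?K * (1 / real n) ^ ?new v w" if v: "v \<in> ?W" and w: "w \<in> ?W" for v w
  proof -
    consider (disj) "v ` {..<k} \<inter> w ` {..<k} = {}" | (same) "cycle_edges k w = cycle_edges k v"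
      | (meet) "v ` {..<k} \<inter> w ` {..<k} \<noteq> {}" "cycle_edges k w \<noteq> cycle_edges k v" by blast
    then show ?thesis
    proof cases
      case disj
      then show ?thesis using prob_disjoint_cycles[OF k v w disj] q C_ge_1 by simp
    next
      case same
      then show ?thesis using prob_cycle[OF k v] C_ge_1 by simp
    next
      case meet
      then show ?thesis using prob_overlapping_cycles_le[OF k v w meet] q by (simp add: add_increasing)
    qed
  qed
  have inner: "(\<Sum>w\<in>?W. ?p v w) \<le> real (card ?W) * ?q\<^sup>2 + real (k\<^sup>2) * ?q + ?K * real (k + 1) ^ k"
    if v: "v \<in> ?W" for v
  proof -
    have "(\<Sum>w\<in>?W. ?p v w) \<le> (\<Sum>w\<in>?W. ?q\<^sup>2 + (if cycle_edges k w = cycle_edges k v then ?q else 0)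
                  + ?K * (1 / real n) ^ ?new v w)"
      by (intro sum_mono bound v)
    also have "\<dots> = real (card ?W) * ?q\<^sup>2 + real (card {w \<in> ?W. cycle_edges k w = cycle_edges k v}) * ?q
        + ?K * (\<Sum>w\<in>?W. (1 / real n) ^ ?new v w)"
      unfolding sum.distrib sum_distrib_left[symmetric]
      using finite_cycle_maps by (simp add: sum.If_cases Int_def)
    also have "\<dots> \<le> real (card ?W) * ?q\<^sup>2 + real (k\<^sup>2) * ?q + ?K * real (k + 1) ^ k"
      using card_same_cycle_edges[OF k v] q C_ge_1 n card_image_le[of "{..<k}" v]
      by (intro add_mono mult_left_mono mult_right_mono order_refl sum_new_vertices_le) auto
    finally show ?thesis .
  qed
  have "measure_pmf.expectation ?P (\<lambda>G. (cycle_count n k G)\<^sup>2) = (\<Sum>v\<in>?W. \<Sum>w\<in>?W. ?p v w)"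
    by (rule expectation_cycle_count_square)
  also have "\<dots> \<le> (\<Sum>v\<in>?W. real (card ?W) * ?q\<^sup>2 + real (k\<^sup>2) * ?q + ?K * real (k + 1) ^ k)"
    by (intro sum_mono inner)
  \<comment> \<open>The first summand is exactly the squared mean and cancels in the variance; only
    the rest is bounded through \<open>card ?W \<le> n ^ k\<close>.\<close>
  also have "\<dots> = (real (card ?W) * ?q)\<^sup>2 + real (card ?W) * (real (k\<^sup>2) * ?q + ?K * real (k + 1) ^ k)"
    by (simp add: algebra_simps power2_eq_square)
  also have "\<dots> \<le> (real (card ?W) * ?q)\<^sup>2 + real n ^ k * (real (k\<^sup>2) * ?q + ?K * real (k + 1) ^ k)"
    using card_cycle_maps_le[of n k] q C_ge_1
    by (intro add_left_mono mult_right_mono add_nonneg_nonneg mult_nonneg_nonneg)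
      (auto simp flip: of_nat_power)
  also have "real n ^ k * (real (k\<^sup>2) * ?q + ?K * real (k + 1) ^ k)
      = real k ^ 2 * cycle_moment m \<pi> k + C ^ (2 * k + 1) * real (k + 1) ^ k / real n"
    using n by (simp add: field_simps)
  finally have "measure_pmf.expectation ?P (\<lambda>G. (cycle_count n k G)\<^sup>2)
      \<le> (measure_pmf.expectation ?P (cycle_count n k))\<^sup>2
        + (real k ^ 2 * cycle_moment m \<pi> k + C ^ (2 * k + 1) * real (k + 1) ^ k / real n)"
    by (simp add: expectation_cycle_count_kernel[OF k])
  moreover have "integrable (measure_pmf ?P) (cycle_count n k)" "integrable (measure_pmf ?P) (\<lambda>G. (cycle_count n k G)\<^sup>2)"
    by (rule integrable_bounded_pmf cycle_count_bounds zero_le_power2 power_mono)+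
  ultimately show ?thesis
    by (simp add: measure_pmf.variance_eq)
qed

end

end

section \<open>Separating the two models\<close>

text \<open>The sets minimising the sum of the two error probabilities serve for all \<open>\<epsilon>\<close> at once, so
  no diagonal argument over tests of increasing quality is needed.\<close>

lemma asymptotically_orthogonalI:
  assumes "\<And>\<epsilon>. \<epsilon> > 0 \<Longrightarrow> \<exists>\<Omega>. (\<forall>n. \<Omega> n \<subseteq> graphs_on n) \<and>
     (\<forall>\<^sub>F n in sequentially. measure_pmf.prob (P n) (\<Omega> n) \<ge> 1 - \<epsilon> \<and> measure_pmf.prob (Q n) (\<Omega> n) \<le> \<epsilon>)"
  shows "asymptotically_orthogonal P Q"
proof -
  \<comment> \<open>Up to the constant 1, \<open>f n A\<close> is the sum of the two error
    probabilities of the test \<open>A\<close>.\<close>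
  define f where "f = (\<lambda>n A. measure_pmf.prob (Q n) A - measure_pmf.prob (P n) A)"
  define A where "A = (\<lambda>n. arg_min_on (f n) (Pow (graphs_on n)))"
  have fin: "finite (Pow (graphs_on n))" "Pow (graphs_on n) \<noteq> {}" for n
    using finite_graphs_on by auto
  have A: "A n \<subseteq> graphs_on n" for n
    using arg_min_if_finite(1)[OF fin, of "f n" n] by (auto simp: A_def)
  have least: "f n (A n) \<le> f n B" if "B \<subseteq> graphs_on n" for n B
    unfolding A_def using that by (intro arg_min_least fin) auto
  have ev: "\<forall>\<^sub>F n in sequentially. measure_pmf.prob (P n) (A n) > 1 - \<epsilon> \<and> measure_pmf.prob (Q n) (A n) < \<epsilon>"
    if \<epsilon>: "\<epsilon> > 0" for \<epsilon>
  proof -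
    obtain \<Omega> where \<Omega>: "\<And>n. \<Omega> n \<subseteq> graphs_on n"
      and ev: "\<forall>\<^sub>F n in sequentially. measure_pmf.prob (P n) (\<Omega> n) \<ge> 1 - \<epsilon> / 3 \<and> measure_pmf.prob (Q n) (\<Omega> n) \<le> \<epsilon> / 3"
      \<comment> \<open>With thirds, the two errors of the minimising set add up to at most
        \<open>2 * \<epsilon> / 3\<close>, so each is strictly below
        \<open>\<epsilon>\<close>.\<close>
      using assms[of "\<epsilon> / 3"] \<epsilon> by auto
    from ev show ?thesis
    proof eventually_elim
      case (elim n)
      have "f n (A n) \<le> f n (\<Omega> n)" by (rule least[OF \<Omega>])
      then show ?case
        using elim \<epsilon> measure_pmf.prob_le_1[of "P n" "A n"] measure_nonneg[of "Q n" "A n"]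
        unfolding f_def by linarith
    qed
  qed
  have "(\<lambda>n. measure_pmf.prob (P n) (A n)) \<longlonglongrightarrow> 1"
  proof (rule order_tendstoI)
    fix a :: real assume "a < 1"
    then show "\<forall>\<^sub>F n in sequentially. a < measure_pmf.prob (P n) (A n)"
      using ev[of "1 - a"] by (auto elim: eventually_mono)
  next
    fix a :: real assume "1 < a"
    then show "\<forall>\<^sub>F n in sequentially. measure_pmf.prob (P n) (A n) < a"
      by (intro always_eventually allI) (metis le_less_trans measure_pmf.prob_le_1)
  qed
  moreover have "(\<lambda>n. measure_pmf.prob (Q n) (A n)) \<longlonglongrightarrow> 0"
  proof (rule order_tendstoI)
    fix a :: real assume "a < 0"
    then show "\<forall>\<^sub>F n in sequentially. a < measure_pmf.prob (Q n) (A n)"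
      by (intro always_eventually allI) (metis less_le_trans measure_nonneg)
  next
    fix a :: real assume "0 < a"
    then show "\<forall>\<^sub>F n in sequentially. measure_pmf.prob (Q n) (A n) < a"
      using ev[of a] by (auto elim: eventually_mono)
  qed
  ultimately show ?thesis
    unfolding asymptotically_orthogonal_def using A by blast
qed

section \<open>From the variance bound to a test\<close>

lemma cycle_count_Chebyshev:
  assumes "a > 0"
  shows "measure_pmf.prob P {G. a \<le> \<bar>cycle_count n k G - measure_pmf.expectation P (cycle_count n k)\<bar>}
       \<le> measure_pmf.variance P (cycle_count n k) / a\<^sup>2"
proof -
  have "integrable (measure_pmf P) (\<lambda>G. (cycle_count n k G)\<^sup>2)"
    by (rule integrable_bounded_pmf cycle_count_bounds zero_le_power2 power_mono)+
  then show ?thesis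
    using measure_pmf.Chebyshev_inequality[of "cycle_count n k" P a] assms by simp
qed

lemma cycle_moment_const: "cycle_moment (\<lambda>_ _. d) \<pi> k = d ^ k"
  by (simp add: cycle_moment_def)

text \<open>A labelling has probability equal to the product of the \<open>pmf \<pi> (t i)\<close>.
  Attached to the step leaving \<open>t i\<close> and divided by \<open>d\<close>, this weight turns
  the kernel into an entry of \<open>transition_matrix\<close>; the average becomes
  \<open>d ^ k\<close> times a sum over closed walks, which is a trace.\<close>

lemma cycle_moment_eq_sum_eigenvalues:
  fixes M :: "real mat"
  assumes \<pi>: "set_pmf \<pi> \<subseteq> {..<s}" and M: "M \<in> carrier_mat s s" and d: "d > 0" and k: "k > 0"
    and m: "\<And>i j. i < s \<Longrightarrow> j < s \<Longrightarrow> m i j = M $$ (i, j)"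
    and cp: "char_poly (transition_matrix s d \<pi> M) = (\<Prod>i\<in>{1..s}. [:- lam i, 1:])"
  shows "cycle_moment m \<pi> k = d ^ k * (\<Sum>i\<in>{1..s}. lam i ^ k)"
proof -
  let ?T = "transition_matrix s d \<pi> M" and ?S = "PiE_dflt {..<k} 0 (\<lambda>_. {..<s})"
  have T: "?T \<in> carrier_mat s s" 
    unfolding transition_matrix_def using M
    by (intro smult_carrier_mat mult_carrier_mat[of _ s s]) (auto simp: mat_diag_def)
  have entry: "?T $$ (i, j) = pmf \<pi> i * M $$ (i, j) / d" if "i < s" "j < s" for i j
    using that M by (simp add: transition_matrix_def mat_diag_mult_left)
  have "finite ?S" by (intro finite_PiE_dflt) auto
  moreover have "set_pmf (Pi_pmf {..<k} 0 (\<lambda>_. \<pi>)) \<subseteq> ?S"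
    using \<pi> by (auto simp: set_Pi_pmf PiE_dflt_def)
  ultimately have "cycle_moment m \<pi> k
      = (\<Sum>t\<in>?S. (\<Prod>i<k. m (t i) (t (Suc i mod k))) * pmf (Pi_pmf {..<k} 0 (\<lambda>_. \<pi>)) t)"
    unfolding cycle_moment_def by (intro integral_measure_pmf_real) auto
  also have "\<dots> = (\<Sum>t\<in>?S. d ^ k * (\<Prod>i<k. ?T $$ (t i, t (Suc i mod k))))"
  proof (rule sum.cong)
    fix t assume t: "t \<in> ?S"
    then have ts: "t i < s" if "i < k" for i using that by (auto simp: PiE_dflt_def)
    have "(\<Prod>i<k. ?T $$ (t i, t (Suc i mod k))) = (\<Prod>i<k. pmf \<pi> (t i) * m (t i) (t (Suc i mod k)) / d)"
      using ts k by (intro prod.cong) (auto simp: entry m)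
    also have "\<dots> = (\<Prod>i<k. pmf \<pi> (t i)) * (\<Prod>i<k. m (t i) (t (Suc i mod k))) / d ^ k"
      by (simp add: prod_dividef prod.distrib)
    finally show "(\<Prod>i<k. m (t i) (t (Suc i mod k))) * pmf (Pi_pmf {..<k} 0 (\<lambda>_. \<pi>)) t
        = d ^ k * (\<Prod>i<k. ?T $$ (t i, t (Suc i mod k)))"
      using t d by (subst pmf_Pi') (auto simp: PiE_dflt_def)
  qed simp
  also have "\<dots> = d ^ k * (\<Sum>i\<in>{1..s}. lam i ^ k)"
    by (simp add: sum_distrib_left[symmetric] sum_closed_walks[OF T k] trace_pow_mat_eq_sum_eigenvalues[OF T cp])
  finally show ?thesis .
qed

text \<open>Exponential growth beats the quadratic factor. Even \<open>k\<close> will make all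
  \<open>lam i ^ k\<close> nonnegative; the 16 stems from the margin \<open>\<delta> / 4\<close> in
  Chebyshev's inequality.\<close>

lemma exists_even_power_dominating:
  fixes \<rho> \<epsilon> :: real
  assumes "\<rho> > 1" "\<epsilon> > 0"
  obtains k :: nat where "even k" "k \<ge> 3" "16 * (real k ^ 2 * real s + 1) / \<rho> ^ k \<le> \<epsilon>"
proof -
  have "(\<lambda>j. 16 * (real (2 * j + 4) ^ 2 * real s + 1) / \<rho> ^ (2 * j + 4)) \<longlonglongrightarrow> 0"
    using assms by real_asymp
  then have "\<forall>\<^sub>F j in sequentially. 16 * (real (2 * j + 4) ^ 2 * real s + 1) / \<rho> ^ (2 * j + 4) < \<epsilon>"
    using assms by (intro order_tendstoD)
  then obtain j where "16 * (real (2 * j + 4) ^ 2 * real s + 1) / \<rho> ^ (2 * j + 4) < \<epsilon>"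
    by (auto dest: eventually_happens)
  then show thesis by (intro that[of "2 * j + 4"]) auto
qed

text \<open>The strict bound by \<open>B\<close> absorbs, for large \<open>n\<close>, the term of
  order \<open>1 / n\<close> in the variance estimate.\<close>

lemma (in edge_kernel) eventually_cycle_count_deviation:
  assumes k: "k \<ge> 3" and B: "real k ^ 2 * cycle_moment m \<pi> k < B" and a: "a > 0"
  shows "\<forall>\<^sub>F n in sequentially.
    measure_pmf.prob (kernel_graph n m \<pi>)
      {G. a \<le> \<bar>cycle_count n k G - real (card (cycle_maps n k)) / real n ^ k * cycle_moment m \<pi> k\<bar>} \<le> B / a\<^sup>2"
proof -
  let ?K = "C ^ (2 * k + 1) * real (k + 1) ^ k"
  have "(\<lambda>n. real k ^ 2 * cycle_moment m \<pi> k + ?K / real n) \<longlonglongrightarrow> real k ^ 2 * cycle_moment m \<pi> k + 0"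
    by (intro tendsto_intros lim_const_over_n)
  then have "\<forall>\<^sub>F n in sequentially. real k ^ 2 * cycle_moment m \<pi> k + ?K / real n < B"
    using B by (intro order_tendstoD) simp_all
  moreover have "\<forall>\<^sub>F n in sequentially. C \<le> real n"
    using filterlim_real_sequentially by (auto simp: filterlim_at_top)
  ultimately show ?thesis
  proof eventually_elim
    case (elim n)
    let ?P = "kernel_graph n m \<pi>"
    have "measure_pmf.variance ?P (cycle_count n k) \<le> B"
      using variance_cycle_count_le[OF elim(2) k] elim(1) by linarith
    then have "measure_pmf.variance ?P (cycle_count n k) / a\<^sup>2 \<le> B / a\<^sup>2"
      by (rule divide_right_mono) simp
    with cycle_count_Chebyshev[OF a, of ?P n k] show ?case
      unfolding expectation_cycle_count_kernel[OF elim(2) k] by (rule order_trans)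
  qed
qed

theorem theorem3p2:
  fixes s :: nat and \<pi> :: "nat pmf" and M :: "real mat" and d :: real and lam :: "nat \<Rightarrow> real"
  assumes "s \<ge> 2"
    and "set_pmf \<pi> \<subseteq> {..<s}"
    and "M \<in> carrier_mat s s"
    and "transpose_mat M = M"
    and "\<And>i j. i < s \<Longrightarrow> j < s \<Longrightarrow> M $$ (i, j) \<ge> 0"
    and "\<And>i. i < s \<Longrightarrow> (\<Sum>j<s. M $$ (i, j) * pmf \<pi> j) = d"
    and "d > 0"
    and "ordered_eigenvalues s (transition_matrix s d \<pi> M) lam"
    and "lam 1 = 1"
    and "d * (lam 2)\<^sup>2 > 1"
  shows "asymptotically_orthogonal
           (\<lambda>n. stochastic_block_model n M \<pi>)
           (\<lambda>n. erdos_renyi n (d / real n))"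
proof -
  note s = \<open>s \<ge> 2\<close> and M = \<open>M \<in> carrier_mat s s\<close> and d = \<open>d > 0\<close>
  \<comment> \<open>The value zero outside the label range makes the kernel bounds hold for all
    natural numbers.\<close>
  define m where "m = (\<lambda>i j. if i < s \<and> j < s then M $$ (i, j) else 0)"
  \<comment> \<open>One bound for both kernels: \<open>d\<close> covers the constant one, the sum of
    all entries covers \<open>m\<close>, and the 1 gives \<open>1 \<le> C\<close>.\<close>
  define C where "C = 1 + d + (\<Sum>i<s. \<Sum>j<s. M $$ (i, j))"
  define \<rho> where "\<rho> = d * (lam 2)\<^sup>2"
  have msym: "m i j = m j i" for i j
  proof (cases "i < s \<and> j < s")
    case True
    then have "M $$ (i, j) = transpose_mat M $$ (j, i)" using M by simp
    then show ?thesis using True assms(4) by (simp add: m_def)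
  qed (auto simp: m_def)
  have rows: "0 \<le> (\<Sum>j<s. M $$ (i, j))" if "i < s" for i
    using that assms(5) by (auto intro: sum_nonneg)
  have tot: "0 \<le> (\<Sum>i<s. \<Sum>j<s. M $$ (i, j))" by (auto intro: sum_nonneg rows)
  have entry_le: "M $$ (i, j) \<le> (\<Sum>i<s. \<Sum>j<s. M $$ (i, j))" if "i < s" "j < s" for i j
  proof -
    have "M $$ (i, j) \<le> (\<Sum>j<s. M $$ (i, j))"
      using that assms(5) by (intro member_le_sum) auto
    also have "\<dots> \<le> (\<Sum>i<s. \<Sum>j<s. M $$ (i, j))"
      using that rows by (intro member_le_sum) auto
    finally show ?thesis .
  qed
  interpret P: edge_kernel m C \<pi>
  proof
    show "m i j \<le> C" for i j
      using entry_le[of i j] tot d by (auto simp: m_def C_def)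
  qed (use msym assms(5) tot d in \<open>auto simp: m_def C_def\<close>)
  interpret Q: edge_kernel "\<lambda>_ _. d" C \<pi>
    using tot d by unfold_locales (auto simp: C_def)
  have cp: "char_poly (transition_matrix s d \<pi> M) = (\<Prod>i\<in>{1..s}. [:- lam i, 1:])"
    and ord: "\<And>i j. 1 \<le> i \<Longrightarrow> i \<le> j \<Longrightarrow> j \<le> s \<Longrightarrow> \<bar>lam j\<bar> \<le> \<bar>lam i\<bar>"
    using assms(8) by (auto simp: ordered_eigenvalues_def)
  have lam_le: "\<bar>lam i\<bar> \<le> 1" if "1 \<le> i" "i \<le> s" for i
    using ord[of 1 i] that assms(9) by simp
  have "(lam 2)\<^sup>2 \<le> 1" using lam_le[of 2] s by (simp add: abs_square_le_1)
  then have "d * (lam 2)\<^sup>2 \<le> d * 1" using d by (intro mult_left_mono) auto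
  then have d1: "1 \<le> d" using assms(10) by simp
  have "lam 2 \<noteq> 0" using assms(10) by auto
  show ?thesis
  proof (rule asymptotically_orthogonalI)
    fix \<epsilon> :: real assume \<epsilon>: "\<epsilon> > 0"
    obtain k where k: "even k" "k \<ge> 3" and small: "16 * (real k ^ 2 * real s + 1) / \<rho> ^ k \<le> \<epsilon>"
      using exists_even_power_dominating[of \<rho> \<epsilon> s] assms(10) \<epsilon> by (auto simp: \<rho>_def)
    define \<tau> where "\<tau> = cycle_moment m \<pi> k"
    \<comment> \<open>The contribution of the second eigenvalue, a lower bound for the gap between
      the limiting means \<open>\<tau>\<close> and \<open>d ^ k\<close>.\<close>
    define \<delta> where "\<delta> = (d * lam 2) ^ k"
    \<comment> \<open>Both limiting means are at most \<open>s * d ^ k\<close>; the additional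
      \<open>d ^ k\<close> makes the variance bound strict.\<close>
    define B where "B = (real k ^ 2 * real s + 1) * d ^ k"
    \<comment> \<open>The threshold lies \<open>\<delta> / 2\<close> above the limiting Erdos-Renyi
      mean and at least as far below \<open>\<tau>\<close>. In the block model this leaves
      \<open>\<delta> / 4\<close> for the convergence of the mean and \<open>\<delta> / 4\<close>
      for fluctuations.\<close>
    define \<Omega> where "\<Omega> = (\<lambda>n. {G \<in> graphs_on n. d ^ k + \<delta> / 2 \<le> cycle_count n k G})"
    have dk: "1 \<le> d ^ k" using d1 by simp
    have B: "B = real k ^ 2 * (d ^ k * real s) + d ^ k" by (simp add: B_def algebra_simps)
    have \<delta>: "\<delta> > 0" using k(1) d \<open>lam 2 \<noteq> 0\<close> by (simp add: \<delta>_def zero_less_power_eq)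
    have lamk: "0 \<le> lam i ^ k" for i using k(1) by (simp add: zero_le_even_power)
    have \<tau>: "\<tau> = d ^ k * (\<Sum>i\<in>{1..s}. lam i ^ k)"
      unfolding \<tau>_def using k(2) assms(2) M d cp
      by (intro cycle_moment_eq_sum_eigenvalues) (auto simp: m_def)
    \<comment> \<open>Only the first two eigenvalues are kept; the other even powers are
      nonnegative.\<close>
    have "1 + lam 2 ^ k = (\<Sum>i\<in>{1, 2}. lam i ^ k)" using assms(9) by simp
    also have "\<dots> \<le> (\<Sum>i\<in>{1..s}. lam i ^ k)" using s lamk by (intro sum_mono2) auto
    finally have "d ^ k * (1 + lam 2 ^ k) \<le> \<tau>" unfolding \<tau> using d by (intro mult_left_mono) auto
    then have \<tau>_ge: "d ^ k + \<delta> \<le> \<tau>" by (simp add: \<delta>_def power_mult_distrib algebra_simps)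
    have "(\<Sum>i\<in>{1..s}. lam i ^ k) \<le> (\<Sum>i\<in>{1..s}. 1)"
    proof (rule sum_mono)
      fix i assume "i \<in> {1..s}"
      then have "\<bar>lam i\<bar> ^ k \<le> 1" using lam_le[of i] by (intro power_le_one) auto
      then show "lam i ^ k \<le> 1" using k(1) by (simp add: power_even_abs)
    qed
    then have "\<tau> \<le> d ^ k * real s" unfolding \<tau> using d by (intro mult_left_mono) auto
    then have "real k ^ 2 * \<tau> \<le> real k ^ 2 * (d ^ k * real s)" by (intro mult_left_mono) auto
    then have BP: "real k ^ 2 * \<tau> < B" using dk unfolding B by linarith
    have "d ^ k * 1 \<le> d ^ k * real s" using s d by (intro mult_left_mono) auto
    then have "real k ^ 2 * d ^ k \<le> real k ^ 2 * (d ^ k * real s)" by (intro mult_left_mono) auto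
    then have BQ: "real k ^ 2 * cycle_moment (\<lambda>_ _. d) \<pi> k < B"
      using dk unfolding B cycle_moment_const by linarith
    \<comment> \<open>The squared gap exceeds the variance scale \<open>d ^ k\<close> by the factor
      \<open>\<rho> ^ k\<close>, which is where \<open>\<rho> > 1\<close> pays off.\<close>
    have "\<delta>\<^sup>2 = d ^ k * \<rho> ^ k"
      by (simp add: \<delta>_def \<rho>_def power_mult_distrib power2_eq_square)
    then have "B / (\<delta> / 4)\<^sup>2 = (16 * (real k ^ 2 * real s + 1)) * d ^ k / (\<rho> ^ k * d ^ k)"
      by (simp add: B_def power_divide mult_ac)
    also have "\<dots> = 16 * (real k ^ 2 * real s + 1) / \<rho> ^ k"
      using d by (intro mult_divide_mult_cancel_right) simp
    finally have "B / (\<delta> / 4)\<^sup>2 = 16 * (real k ^ 2 * real s + 1) / \<rho> ^ k" .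
    with small have err: "B / (\<delta> / 4)\<^sup>2 \<le> \<epsilon>" by simp
    have lim: "(\<lambda>n. real (card (cycle_maps n k)) / real n ^ k * \<tau>) \<longlonglongrightarrow> 1 * \<tau>"
      by (intro tendsto_intros card_cycle_maps_asymp)
    have "\<tau> - \<delta> / 4 < 1 * \<tau>" "0 < \<delta> / 4" using \<delta> by linarith+
    from order_tendstoD(1)[OF lim this(1)]
    have "\<forall>\<^sub>F n in sequentially. \<tau> - \<delta> / 4 < real (card (cycle_maps n k)) / real n ^ k * \<tau>" .
    moreover note P.eventually_cycle_count_deviation[OF k(2) BP[unfolded \<tau>_def] \<open>0 < \<delta> / 4\<close>]
    moreover note Q.eventually_cycle_count_deviation[OF k(2) BQ \<open>0 < \<delta> / 4\<close>]
    ultimately have "\<forall>\<^sub>F n in sequentially. 1 - \<epsilon> \<le> measure_pmf.prob (kernel_graph n m \<pi>) (\<Omega> n)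
        \<and> measure_pmf.prob (kernel_graph n (\<lambda>_ _. d) \<pi>) (\<Omega> n) \<le> \<epsilon>"
      using eventually_gt_at_top[of 0]
    proof (eventually_elim, goal_cases)
      case (1 n)
      let ?P = "kernel_graph n m \<pi>" and ?Q = "kernel_graph n (\<lambda>_ _. d) \<pi>"
      let ?r = "real (card (cycle_maps n k)) / real n ^ k"
      \<comment> \<open>The Erdos-Renyi mean never exceeds its limit \<open>d ^ k\<close>, so
        reaching the threshold is a deviation of at least \<open>\<delta> / 2\<close>.\<close>
      have "real (card (cycle_maps n k)) \<le> real n ^ k"
        using card_cycle_maps_le[of n k] by (simp flip: of_nat_power)
      then have "?r \<le> 1" using 1 by (simp add: divide_le_eq_1)
      then have "?r * d ^ k \<le> 1 * d ^ k" using d by (intro mult_right_mono) auto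
      then have "measure_pmf.prob ?Q (\<Omega> n) \<le> measure_pmf.prob ?Q {G. \<delta> / 4 \<le> \<bar>cycle_count n k G - ?r * d ^ k\<bar>}"
        using \<delta> by (intro measure_pmf.finite_measure_mono) (auto simp: \<Omega>_def)
      also have "\<dots> \<le> \<epsilon>" using 1 err by (simp add: cycle_moment_const)
      finally have "measure_pmf.prob ?Q (\<Omega> n) \<le> \<epsilon>" .
      moreover have "1 - measure_pmf.prob ?P (\<Omega> n) = measure_pmf.prob ?P (- \<Omega> n)"
        by (simp add: measure_pmf.prob_compl[symmetric] Compl_eq_Diff_UNIV)
      \<comment> \<open>The complement also contains edge sets outside \<open>graphs_on n\<close>,
        which have probability zero; hence the almost sure comparison. On graphs, a count below
        \<open>\<tau> - \<delta> / 2\<close> meets a mean above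
        \<open>\<tau> - \<delta> / 4\<close>.\<close>
      moreover have "measure_pmf.prob ?P (- \<Omega> n) \<le> measure_pmf.prob ?P {G. \<delta> / 4 \<le> \<bar>cycle_count n k G - ?r * \<tau>\<bar>}"
      proof (intro measure_pmf.finite_measure_mono_AE AE_pmfI impI)
        fix G assume "G \<in> set_pmf ?P" "G \<in> - \<Omega> n"
        then have "cycle_count n k G < d ^ k + \<delta> / 2"
          using set_kernel_graph[of n m \<pi>] by (auto simp: \<Omega>_def)
        then have "\<delta> / 4 \<le> \<bar>cycle_count n k G - ?r * \<tau>\<bar>"
          using 1(1) \<tau>_ge by linarith
        then show "G \<in> {G. \<delta> / 4 \<le> \<bar>cycle_count n k G - ?r * \<tau>\<bar>}" by simp
      qed simp
      moreover have "\<dots> \<le> \<epsilon>" using 1 err by (simp add: \<tau>_def)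
      ultimately show ?case by linarith
    qed
    moreover have "stochastic_block_model n M \<pi> = kernel_graph n m \<pi>" for n
      using assms(2) by (intro stochastic_block_model_eq_kernel_graph) (auto simp: m_def)
    ultimately show "\<exists>\<Omega>. (\<forall>n. \<Omega> n \<subseteq> graphs_on n) \<and>
        (\<forall>\<^sub>F n in sequentially. 1 - \<epsilon> \<le> measure_pmf.prob (stochastic_block_model n M \<pi>) (\<Omega> n) \<and>
          measure_pmf.prob (erdos_renyi n (d / real n)) (\<Omega> n) \<le> \<epsilon>)"
      unfolding erdos_renyi_eq_kernel_graph[of _ d \<pi>]
      by (intro exI[of _ \<Omega>]) (auto simp: \<Omega>_def)
  qed
qed

end
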